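(* Let $S$ be a finite approximation space (finiteness can be relaxed), let $Q=\wp(S)/{\approx}$ be the associated pre-rough algebra of roughly equal objects, and let $K\subseteq Q$ be a lattice L-filter, with induced partial algebraic system $\mathbb{K}=\langle K,\leq,L,U,\neg,1\rangle$. Then $\mathbb{K}$ is not a pre-rough algebra, but it satisfies: 1. $\leq$ is a distributive lattice order; 2. closure under $L$ and $U$, but not under $\neg$; 3. $Lx\leq x$; $L(a\sqcap b)=La\sqcap Lb$; $LLx=Lx$; 4. $L1=1$; $ULx=Lx$; $L(a\sqcup b)=La\sqcup Lb$ (for all $x,a,b\in K$).
   Context: An approximation space is a set $S$ with an equivalence relation $R$. For $A\subseteq S$, $A^{l}$ is the union of the $R$-classes contained in $A$ and $A^{u}$ is the union of the $R$-classes meeting $A$. Sets $A,B\subseteq S$ are roughly equal, $A\approx B$, iff $A^{l}=B^{l}$ and $A^{u}=B^{u}$. On $Q=\wp(S)/{\approx}$ the rough inclusion order is $[A]\leq[B]$ iff $A^{l}\subseteq B^{l}$ and $A^{u}\subseteq B^{u}$; this is a lattice order, with join $\sqcup$ and meet $\sqcap$, least element $0=[\emptyset]$ and greatest element $1=[S]$. The unary operations are $L[A]=[A^{l}]$, $U[A]=[A^{u}]$, $\neg[A]=[S\setminus A]$. With these operations $Q$ is a pre-rough algebra. A pre-rough algebra is a bounded distributive lattice with unary operations $\neg, L$ (and $Ux=\neg L\neg x$) such that $\neg\neg a=a$, $\neg(a\sqcup b)=\neg a\sqcap\neg b$, $La\leq a$, $L(a\sqcap b)=La\sqcap Lb$,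 $LLa=La$, $L1=1$, $ULa=La$, $\neg La\sqcup La=1$, $L(a\sqcup b)=La\sqcup Lb$, and $La\leq Lb$ together with $Ua\leq Ub$ implies $a\leq b$ (superfluous, derived operations are omitted). An arbitrary subset $K\subseteq Q$ is an L-filter iff: (F0) for all $x\in K$ and $y\in Q$, $x\leq y$ implies $y\in K$; and (O1) for all $x\in K$, $Lx\in K$. An L-filter closed under $\sqcap$ and $\sqcup$ is a lattice L-filter. The operations and relation of the partial algebraic system $\mathbb{K}$ are those induced on $K$ from $Q$.
   Formalization: "Not a pre-rough algebra" is claimed only for K ≠ Q, "not closed under ¬" only for K nonempty and K ≠ Q, and 1 ∈ K only for K nonempty: Q itself is a lattice L-filter and a pre-rough algebra, and the empty K is trivially closed under ¬. *)

theory Defs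
  imports "HOL-Algebra.Lattice"
begin

locale distributive_lattice = lattice +
  assumes meet_join_distrib:
    "\<lbrakk>x \<in> carrier L; y \<in> carrier L; z \<in> carrier L\<rbrakk>
      \<Longrightarrow> x \<sqinter> (y \<squnion> z) = (x \<sqinter> y) \<squnion> (x \<sqinter> z)"

record 'a rough_system = "'a gorder" +
  Lop :: "'a \<Rightarrow> 'a"
  Uop :: "'a \<Rightarrow> 'a"
  neg :: "'a \<Rightarrow> 'a"
  unity :: 'a

text \<open>The axioms include totality of the operations on the carrier: a system in which
  some operation leaves the carrier is only a partial algebra and not a pre-rough algebra.
  Join and meet are the ones determined by the order.\<close>

locale pre_rough_algebra = bounded_lattice P + distributive_lattice P
  for P :: "('a, 'b) rough_system_scheme" (structure) +
  assumes Lop_closed: "a \<in> carrier P \<Longrightarrow> Lop P a \<in> carrier P"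
    and Uop_closed: "a \<in> carrier P \<Longrightarrow> Uop P a \<in> carrier P"
    and neg_closed: "a \<in> carrier P \<Longrightarrow> neg P a \<in> carrier P"
    and unity_top: "unity P = \<top>"
    and Uop_eq: "a \<in> carrier P \<Longrightarrow> Uop P a = neg P (Lop P (neg P a))"
    and neg_neg: "a \<in> carrier P \<Longrightarrow> neg P (neg P a) = a"
    and neg_join: "\<lbrakk>a \<in> carrier P; b \<in> carrier P\<rbrakk> \<Longrightarrow> neg P (a \<squnion> b) = neg P a \<sqinter> neg P b"
    and Lop_le: "a \<in> carrier P \<Longrightarrow> Lop P a \<sqsubseteq> a"
    and Lop_meet: "\<lbrakk>a \<in> carrier P; b \<in> carrier P\<rbrakk> \<Longrightarrow> Lop P (a \<sqinter> b) = Lop P a \<sqinter> Lop P b"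
    and Lop_Lop: "a \<in> carrier P \<Longrightarrow> Lop P (Lop P a) = Lop P a"
    and Lop_unity: "Lop P (unity P) = unity P"
    and Uop_Lop: "a \<in> carrier P \<Longrightarrow> Uop P (Lop P a) = Lop P a"
    and neg_Lop_join_Lop: "a \<in> carrier P \<Longrightarrow> neg P (Lop P a) \<squnion> Lop P a = unity P"
    and Lop_join: "\<lbrakk>a \<in> carrier P; b \<in> carrier P\<rbrakk> \<Longrightarrow> Lop P (a \<squnion> b) = Lop P a \<squnion> Lop P b"
    and Lop_Uop_le: "\<lbrakk>a \<in> carrier P; b \<in> carrier P; Lop P a \<sqsubseteq> Lop P b; Uop P a \<sqsubseteq> Uop P b\<rbrakk>
      \<Longrightarrow> a \<sqsubseteq> b"

definition lower_approx :: "'a set \<Rightarrow> ('a \<times> 'a) set \<Rightarrow> 'a set \<Rightarrow> 'a set" where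
  "lower_approx S R A = \<Union>{C \<in> S // R. C \<subseteq> A}"

definition upper_approx :: "'a set \<Rightarrow> ('a \<times> 'a) set \<Rightarrow> 'a set \<Rightarrow> 'a set" where
  "upper_approx S R A = \<Union>{C \<in> S // R. C \<inter> A \<noteq> {}}"

definition rough_eq :: "'a set \<Rightarrow> ('a \<times> 'a) set \<Rightarrow> ('a set \<times> 'a set) set" where
  "rough_eq S R = {(A, B). A \<subseteq> S \<and> B \<subseteq> S \<and>
     lower_approx S R A = lower_approx S R B \<and> upper_approx S R A = upper_approx S R B}"

abbreviation rough_class :: "'a set \<Rightarrow> ('a \<times> 'a) set \<Rightarrow> 'a set \<Rightarrow> 'a set set" where
  "rough_class S R A \<equiv> rough_eq S R `` {A}"

text \<open>The unions below are over all representatives of a class; since the operations respect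
  rough equality, all the sets in such a union coincide (cf. \<open>UN_equiv_class\<close>).\<close>

definition rough_algebra :: "'a set \<Rightarrow> ('a \<times> 'a) set \<Rightarrow> 'a set set rough_system" where
  "rough_algebra S R =
    \<lparr>carrier = Pow S // rough_eq S R,
     eq = (=),
     le = (\<lambda>X Y. \<exists>A\<in>X. \<exists>B\<in>Y. lower_approx S R A \<subseteq> lower_approx S R B \<and>
                              upper_approx S R A \<subseteq> upper_approx S R B),
     Lop = (\<lambda>X. \<Union>A\<in>X. rough_class S R (lower_approx S R A)),
     Uop = (\<lambda>X. \<Union>A\<in>X. rough_class S R (upper_approx S R A)),
     neg = (\<lambda>X. \<Union>A\<in>X. rough_class S R (S - A)),
     unity = rough_class S R S\<rparr>"

definition L_filter :: "('a, 'b) rough_system_scheme \<Rightarrow> 'a set \<Rightarrow> bool" where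
  "L_filter Q K \<longleftrightarrow> K \<subseteq> carrier Q \<and>
     (\<forall>x\<in>K. \<forall>y\<in>carrier Q. x \<sqsubseteq>\<^bsub>Q\<^esub> y \<longrightarrow> y \<in> K) \<and>
     (\<forall>x\<in>K. Lop Q x \<in> K)"

definition lattice_L_filter :: "('a, 'b) rough_system_scheme \<Rightarrow> 'a set \<Rightarrow> bool" where
  "lattice_L_filter Q K \<longleftrightarrow> L_filter Q K \<and>
     (\<forall>x\<in>K. \<forall>y\<in>K. x \<sqinter>\<^bsub>Q\<^esub> y \<in> K \<and> x \<squnion>\<^bsub>Q\<^esub> y \<in> K)"

text \<open>An operation of the induced partial system is defined at those arguments from \<open>K\<close>
  at which its value lies in \<open>K\<close> again, and then it has the value it has in \<open>Q\<close>. Hence it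
  suffices to change the carrier.\<close>

definition induced_system :: "('a, 'b) rough_system_scheme \<Rightarrow> 'a set \<Rightarrow> ('a, 'b) rough_system_scheme"
  where "induced_system Q K = Q\<lparr>carrier := K\<rparr>"

end

theory Submission
  imports Defs
begin

text \<open>A rough object is determined by its pair of approximations, and the order is componentwise
  inclusion of these pairs. The points to check are that the intersection and the union of two such
  pairs are again realised by sets; then meet and join are computed componentwise on definable sets,
  and distributivity and the laws for \<open>L\<close> and \<open>U\<close> are inherited from set algebra. A lattice
  \<open>L\<close>-filter is an upward closed sublattice; a nonempty one contains \<open>1\<close>, so closure under
  negation would put \<open>0 = \<not>1\<close>, and hence everything, into it.\<close>

section \<open>Meets, joins and sublattices of ordered structures\<close>

lemma (in partial_order) meet_eqI:
  assumes "x \<in> carrier L" "y \<in> carrier L" "m \<in> carrier L" "m \<sqsubseteq> x" "m \<sqsubseteq> y"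
    and "\<And>z. \<lbrakk>z \<in> carrier L; z \<sqsubseteq> x; z \<sqsubseteq> y\<rbrakk> \<Longrightarrow> z \<sqsubseteq> m"
  shows "greatest L m (Lower L {x, y})" and "x \<sqinter> y = m"
proof -
  show m: "greatest L m (Lower L {x, y})"
    using assms by (auto simp: greatest_def Lower_def)
  \<comment> \<open>The meet is some greatest lower bound picked by choice; antisymmetry leaves only
    one candidate, so exhibiting a bound computes it.\<close>
  then show "x \<sqinter> y = m"
    unfolding meet_def inf_def using greatest_unique by blast
qed

lemma (in partial_order) join_eqI:
  assumes "x \<in> carrier L" "y \<in> carrier L" "m \<in> carrier L" "x \<sqsubseteq> m" "y \<sqsubseteq> m"
    and "\<And>z. \<lbrakk>z \<in> carrier L; x \<sqsubseteq> z; y \<sqsubseteq> z\<rbrakk> \<Longrightarrow> m \<sqsubseteq> z"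
  shows "least L m (Upper L {x, y})" and "x \<squnion> y = m"
proof -
  show m: "least L m (Upper L {x, y})"
    using assms by (auto simp: least_def Upper_def)
  then show "x \<squnion> y = m"
    unfolding join_def sup_def using least_unique by blast
qed

text \<open>Meet and join of a structure depend on its carrier. Since \<open>K\<close> contains the
  bounds formed in \<open>L\<close>, these stay optimal among the fewer competitors in
  \<open>K\<close>, so both structures compute the same values and distributivity carries
  over.\<close>

lemma (in distributive_lattice) sublattice:
  assumes sub: "K \<subseteq> carrier L"
    and meet: "\<And>x y. \<lbrakk>x \<in> K; y \<in> K\<rbrakk> \<Longrightarrow> x \<sqinter> y \<in> K"
    and join: "\<And>x y. \<lbrakk>x \<in> K; y \<in> K\<rbrakk> \<Longrightarrow> x \<squnion> y \<in> K"
  shows "distributive_lattice (L\<lparr>carrier := K\<rparr>)"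
proof -
  let ?M = "L\<lparr>carrier := K\<rparr>"
  interpret M: partial_order ?M
    using weak_partial_order_subset[OF weak_partial_order_axioms sub]
    by (simp add: partial_order_def partial_order_axioms_def eq_is_equal)
  have M_meet: "greatest ?M (x \<sqinter> y) (Lower ?M {x, y})" "x \<sqinter>\<^bsub>?M\<^esub> y = x \<sqinter> y"
    if "x \<in> K" "y \<in> K" for x y
  proof -
    have xy: "x \<in> carrier L" "y \<in> carrier L" using that sub by auto
    have "z \<sqsubseteq> x \<sqinter> y" if "z \<in> K" "z \<sqsubseteq> x" "z \<sqsubseteq> y" for z
      using that xy sub by (meson meet_le subsetD)
    then show "greatest ?M (x \<sqinter> y) (Lower ?M {x, y})" "x \<sqinter>\<^bsub>?M\<^esub> y = x \<sqinter> y"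
      using that xy meet M.meet_eqI[of x y "x \<sqinter> y"] by (simp_all add: meet_left meet_right)
  qed
  have M_join: "least ?M (x \<squnion> y) (Upper ?M {x, y})" "x \<squnion>\<^bsub>?M\<^esub> y = x \<squnion> y"
    if "x \<in> K" "y \<in> K" for x y
  proof -
    have xy: "x \<in> carrier L" "y \<in> carrier L" using that sub by auto
    have "x \<squnion> y \<sqsubseteq> z" if "z \<in> K" "x \<sqsubseteq> z" "y \<sqsubseteq> z" for z
      using that xy sub by (meson join_le subsetD)
    then show "least ?M (x \<squnion> y) (Upper ?M {x, y})" "x \<squnion>\<^bsub>?M\<^esub> y = x \<squnion> y"
      using that xy join M.join_eqI[of x y "x \<squnion> y"] by (simp_all add: join_left join_right)
  qed
  show ?thesis
  proof unfold_locales
    fix x y assume "x \<in> carrier ?M" "y \<in> carrier ?M"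
    then show "\<exists>s. least ?M s (Upper ?M {x, y})" "\<exists>s. greatest ?M s (Lower ?M {x, y})"
      using M_join(1) M_meet(1) by (simp_all, blast+)
  next
    fix x y z assume "x \<in> carrier ?M" "y \<in> carrier ?M" "z \<in> carrier ?M"
    then show "x \<sqinter>\<^bsub>?M\<^esub> (y \<squnion>\<^bsub>?M\<^esub> z) = x \<sqinter>\<^bsub>?M\<^esub> y \<squnion>\<^bsub>?M\<^esub> x \<sqinter>\<^bsub>?M\<^esub> z"
      using sub meet_join_distrib[of x y z] by (auto simp: M_meet(2) M_join(2) meet join subset_eq)
  qed
qed

section \<open>Lower and upper approximations\<close>

locale approximation_space =
  fixes S :: "'a set" and R :: "('a \<times> 'a) set"
  assumes equiv_R: "equiv S R"
begin

abbreviation lower where "lower \<equiv> lower_approx S R"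
abbreviation upper where "upper \<equiv> upper_approx S R"
abbreviation rough where "rough \<equiv> rough_class S R"
abbreviation RA where "RA \<equiv> rough_algebra S R"

lemma R_refl: "x \<in> S \<Longrightarrow> (x, x) \<in> R"
  and R_sym: "(x, y) \<in> R \<Longrightarrow> (y, x) \<in> R"
  and R_trans: "(x, y) \<in> R \<Longrightarrow> (y, z) \<in> R \<Longrightarrow> (x, z) \<in> R"
  and R_in: "(x, y) \<in> R \<Longrightarrow> x \<in> S" "(x, y) \<in> R \<Longrightarrow> y \<in> S"
  using equiv_R unfolding equiv_def refl_on_def sym_def trans_def by blast+

lemma class_eq: "\<lbrakk>C \<in> S // R; x \<in> C\<rbrakk> \<Longrightarrow> C = R `` {x} \<and> x \<in> S"
  using equiv_class_eq_iff[OF equiv_R] by (metis Image_singleton_iff quotientE)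

lemma class_ex: "x \<in> S \<Longrightarrow> R `` {x} \<in> S // R \<and> x \<in> R `` {x}"
  by (simp add: quotientI R_refl)

lemma lower_eq: "lower A = {x \<in> S. \<forall>y. (x, y) \<in> R \<longrightarrow> y \<in> A}"
proof -
  have "x \<in> lower A \<longleftrightarrow> x \<in> S \<and> R `` {x} \<subseteq> A" for x
    unfolding lower_approx_def using class_eq class_ex by blast
  then show ?thesis by auto
qed

lemma upper_eq: "upper A = {x \<in> S. \<exists>y\<in>A. (x, y) \<in> R}"
proof -
  have "x \<in> upper A \<longleftrightarrow> x \<in> S \<and> R `` {x} \<inter> A \<noteq> {}" for x
    unfolding upper_approx_def using class_eq class_ex by blast
  then show ?thesis by auto
qed

lemma lower_subset_S: "lower A \<subseteq> S" and upper_subset_S: "upper A \<subseteq> S"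
  by (auto simp: lower_eq upper_eq)

lemma lower_subset: "lower A \<subseteq> A"
  unfolding lower_eq using R_refl by blast

lemma lower_subset_upper: "lower A \<subseteq> upper A"
  unfolding lower_eq upper_eq using R_refl by blast

text \<open>Approximations are unions of classes. This is why both operators fix them.\<close>

lemma lower_cong: "(x, y) \<in> R \<Longrightarrow> x \<in> lower A \<longleftrightarrow> y \<in> lower A"
  and upper_cong: "(x, y) \<in> R \<Longrightarrow> x \<in> upper A \<longleftrightarrow> y \<in> upper A"
  unfolding lower_eq upper_eq using R_sym R_trans R_in by blast+

lemma lower_lower: "lower (lower A) = lower A"
  and lower_upper: "lower (upper A) = upper A"
  using lower_subset by (auto simp: lower_eq[of "lower A"] lower_eq[of "upper A"]
    dest: lower_cong upper_cong subsetD[OF lower_subset_S] subsetD[OF upper_subset_S] R_refl)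

lemma upper_upper: "upper (upper A) = upper A"
  and upper_lower: "upper (lower A) = lower A"
  by (auto simp: upper_eq[of "lower A"] upper_eq[of "upper A"]
    dest: lower_cong upper_cong subsetD[OF lower_subset_S] subsetD[OF upper_subset_S] R_refl)

lemma lower_S: "lower S = S" and upper_S: "upper S = S"
  unfolding lower_eq upper_eq using R_refl R_in by blast+

lemma lower_compl: "lower (S - A) = S - upper A"
  and upper_compl: "upper (S - A) = S - lower A"
  unfolding lower_eq upper_eq using R_in by blast+

section \<open>Sets realising meets and joins\<close>

text \<open>The intersection alone has too small an upper approximation. On the classes that meet
  both sets but not their intersection, the points of the first set are added.\<close>

definition rmeet :: "'a set \<Rightarrow> 'a set \<Rightarrow> 'a set" where
  "rmeet A B = (A \<inter> B) \<union> (A \<inter> upper B - upper (A \<inter> B))"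

lemma rmeet_subset: "A \<subseteq> S \<Longrightarrow> rmeet A B \<subseteq> S"
  by (auto simp: rmeet_def)

text \<open>A class inside \<open>rmeet A B\<close> lies in \<open>A\<close>. A point of it outside
  \<open>B\<close> would be an added one, so the class would meet \<open>B\<close>, hence
  \<open>A \<inter> B\<close>, which the added points exclude.\<close>

lemma lower_rmeet: "lower (rmeet A B) = lower A \<inter> lower B"
proof
  show "lower A \<inter> lower B \<subseteq> lower (rmeet A B)"
    by (auto simp: lower_eq rmeet_def)
  show "lower (rmeet A B) \<subseteq> lower A \<inter> lower B"
  proof
    fix x assume x: "x \<in> lower (rmeet A B)"
    then have xS: "x \<in> S" and D: "\<And>y. (x, y) \<in> R \<Longrightarrow> y \<in> rmeet A B"
      by (auto simp: lower_eq)
    then have A: "\<And>y. (x, y) \<in> R \<Longrightarrow> y \<in> A"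
      by (auto simp: rmeet_def)
    have "y \<in> B" if y: "(x, y) \<in> R" for y
    proof (rule ccontr)
      assume "y \<notin> B"
      with D[OF y] have "y \<in> upper B" and n: "y \<notin> upper (A \<inter> B)"
        by (auto simp: rmeet_def)
      then obtain z where "z \<in> B" "(y, z) \<in> R" "y \<in> S"
        by (auto simp: upper_eq)
      with A[of z] R_trans[OF y] n show False
        by (auto simp: upper_eq)
    qed
    with A xS show "x \<in> lower A \<inter> lower B"
      by (auto simp: lower_eq)
  qed
qed

text \<open>A class meeting both \<open>A\<close> and \<open>B\<close> either meets
  \<open>A \<inter> B\<close>, or all its points in \<open>A\<close> are added ones.\<close>

lemma upper_rmeet: "upper (rmeet A B) = upper A \<inter> upper B"
proof
  show "upper (rmeet A B) \<subseteq> upper A \<inter> upper B"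
    using R_trans unfolding upper_eq rmeet_def by blast
  show "upper A \<inter> upper B \<subseteq> upper (rmeet A B)"
  proof
    fix x assume "x \<in> upper A \<inter> upper B"
    then obtain a b where *: "x \<in> S" "a \<in> A" "(x, a) \<in> R" "b \<in> B" "(x, b) \<in> R"
      by (auto simp: upper_eq)
    show "x \<in> upper (rmeet A B)"
    proof (cases "x \<in> upper (A \<inter> B)")
      case True
      then show ?thesis by (auto simp: upper_eq rmeet_def)
    next
      case False
      with * have "a \<notin> upper (A \<inter> B)"
        using upper_cong by blast
      moreover have "a \<in> upper B"
        using * upper_cong[of x a B] by (auto simp: upper_eq)
      ultimately have "a \<in> rmeet A B"
        using * by (simp add: rmeet_def)
      with * show ?thesis by (auto simp: upper_eq)
    qed
  qed
qed

text \<open>The De Morgan dual of \<open>rmeet\<close>. A plain union can fill a class that neither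
  set contains, making the lower approximation too large.\<close>

definition rjoin :: "'a set \<Rightarrow> 'a set \<Rightarrow> 'a set" where
  "rjoin A B = S - rmeet (S - A) (S - B)"

lemma rjoin_subset: "rjoin A B \<subseteq> S"
  by (auto simp: rjoin_def)

lemma lower_rjoin: "lower (rjoin A B) = lower A \<union> lower B"
  and upper_rjoin: "upper (rjoin A B) = upper A \<union> upper B"
  using lower_subset_S upper_subset_S
  by (auto simp: rjoin_def lower_compl upper_compl lower_rmeet upper_rmeet)

section \<open>The rough algebra computed on representatives\<close>

lemma equiv_rough_eq: "equiv (Pow S) (rough_eq S R)"
  by (rule equivI) (auto simp: rough_eq_def refl_on_def sym_def trans_def)

lemma rough_eq_iff:
  assumes "A \<subseteq> S" "B \<subseteq> S"
  shows "rough A = rough B \<longleftrightarrow> lower A = lower B \<and> upper A = upper B"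
  using assms eq_equiv_class_iff[OF equiv_rough_eq, of A B] by (simp add: rough_eq_def)

lemma carrier_Q: "carrier RA = rough ` Pow S"
  by (auto simp: rough_algebra_def quotient_def)

lemma rough_in_Q [simp]: "A \<subseteq> S \<Longrightarrow> rough A \<in> carrier RA"
  by (auto simp: carrier_Q)

lemma Q_E:
  assumes "x \<in> carrier RA"
  obtains A where "A \<subseteq> S" "x = rough A"
  using assms by (auto simp: carrier_Q)

text \<open>All representatives of a rough class share both approximations, so the existential
  choice in the order is immaterial.\<close>

lemma le_Q:
  assumes "A \<subseteq> S" "B \<subseteq> S"
  shows "rough A \<sqsubseteq>\<^bsub>RA\<^esub> rough B \<longleftrightarrow> lower A \<subseteq> lower B \<and> upper A \<subseteq> upper B"
  using assms by (auto simp: rough_algebra_def rough_eq_def)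

lemma Lop_Q: "A \<subseteq> S \<Longrightarrow> Lop RA (rough A) = rough (lower A)"
  using UN_equiv_class[OF equiv_rough_eq, of "\<lambda>A. rough (lower A)" A]
  by (simp add: rough_algebra_def congruent_def rough_eq_def)

lemma Uop_Q: "A \<subseteq> S \<Longrightarrow> Uop RA (rough A) = rough (upper A)"
  using UN_equiv_class[OF equiv_rough_eq, of "\<lambda>A. rough (upper A)" A]
  by (simp add: rough_algebra_def congruent_def rough_eq_def)

text \<open>Complementation exchanges the two approximations up to complement, hence respects rough
  equality.\<close>

lemma neg_Q:
  assumes "A \<subseteq> S"
  shows "neg RA (rough A) = rough (S - A)"
proof -
  have "(\<lambda>A. rough (S - A)) respects rough_eq S R"
  proof (rule congruentI)
    fix A B assume "(A, B) \<in> rough_eq S R"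
    then show "rough (S - A) = rough (S - B)"
      by (subst rough_eq_iff) (auto simp: rough_eq_def lower_compl upper_compl)
  qed
  from UN_equiv_class[OF equiv_rough_eq this, of A] assms show ?thesis
    by (simp add: rough_algebra_def)
qed

lemma eq_Q: "eq RA = (=)"
  by (simp add: rough_algebra_def)

lemma unity_Q: "unity RA = rough S"
  by (simp add: rough_algebra_def)

sublocale Q: partial_order RA
proof unfold_locales
  fix x y z
  assume xyz: "x \<in> carrier RA" "y \<in> carrier RA"
  show "x .=\<^bsub>RA\<^esub> y" if "x \<sqsubseteq>\<^bsub>RA\<^esub> y" "y \<sqsubseteq>\<^bsub>RA\<^esub> x"
    using xyz that by (elim Q_E) (auto simp: le_Q eq_Q rough_eq_iff)
  show "x \<sqsubseteq>\<^bsub>RA\<^esub> z" if "x \<sqsubseteq>\<^bsub>RA\<^esub> y" "y \<sqsubseteq>\<^bsub>RA\<^esub> z" "z \<in> carrier RA"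
    using xyz that by (elim Q_E) (auto simp: le_Q)
next
  fix x assume "x \<in> carrier RA"
  then show "x \<sqsubseteq>\<^bsub>RA\<^esub> x" by (elim Q_E) (simp add: le_Q)
qed (simp_all add: eq_Q)

text \<open>The pair of approximations of \<open>rmeet A B\<close> is the componentwise
  intersection, which is the greatest pair below both given pairs.\<close>

lemma Q_meet:
  assumes "A \<subseteq> S" "B \<subseteq> S"
  shows "greatest RA (rough (rmeet A B)) (Lower RA {rough A, rough B})"
    and "rough A \<sqinter>\<^bsub>RA\<^esub> rough B = rough (rmeet A B)"
proof -
  have "z \<sqsubseteq>\<^bsub>RA\<^esub> rough (rmeet A B)"
    if "z \<in> carrier RA" "z \<sqsubseteq>\<^bsub>RA\<^esub> rough A" "z \<sqsubseteq>\<^bsub>RA\<^esub> rough B" for z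
    using that assms by (elim Q_E) (simp add: le_Q rmeet_subset lower_rmeet upper_rmeet)
  then show "greatest RA (rough (rmeet A B)) (Lower RA {rough A, rough B})"
    and "rough A \<sqinter>\<^bsub>RA\<^esub> rough B = rough (rmeet A B)"
    using assms Q.meet_eqI[of "rough A" "rough B" "rough (rmeet A B)"]
    by (simp_all add: le_Q rmeet_subset lower_rmeet upper_rmeet)
qed

lemma Q_join:
  assumes "A \<subseteq> S" "B \<subseteq> S"
  shows "least RA (rough (rjoin A B)) (Upper RA {rough A, rough B})"
    and "rough A \<squnion>\<^bsub>RA\<^esub> rough B = rough (rjoin A B)"
proof -
  have "rough (rjoin A B) \<sqsubseteq>\<^bsub>RA\<^esub> z"
    if "z \<in> carrier RA" "rough A \<sqsubseteq>\<^bsub>RA\<^esub> z" "rough B \<sqsubseteq>\<^bsub>RA\<^esub> z" for z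
    using that assms by (elim Q_E) (simp add: le_Q rjoin_subset lower_rjoin upper_rjoin)
  then show "least RA (rough (rjoin A B)) (Upper RA {rough A, rough B})"
    and "rough A \<squnion>\<^bsub>RA\<^esub> rough B = rough (rjoin A B)"
    using assms Q.join_eqI[of "rough A" "rough B" "rough (rjoin A B)"]
    by (simp_all add: le_Q rjoin_subset lower_rjoin upper_rjoin)
qed

sublocale Q: distributive_lattice RA
proof unfold_locales
  fix x y assume "x \<in> carrier RA" "y \<in> carrier RA"
  then show "\<exists>s. least RA s (Upper RA {x, y})" "\<exists>s. greatest RA s (Lower RA {x, y})"
    using Q_join(1) Q_meet(1) by (metis Q_E)+
next
  fix x y z assume "x \<in> carrier RA" "y \<in> carrier RA" "z \<in> carrier RA"
  then show "x \<sqinter>\<^bsub>RA\<^esub> (y \<squnion>\<^bsub>RA\<^esub> z) = x \<sqinter>\<^bsub>RA\<^esub> y \<squnion>\<^bsub>RA\<^esub> x \<sqinter>\<^bsub>RA\<^esub> z"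
    by (elim Q_E)
      (auto simp: Q_meet(2) Q_join(2) rmeet_subset rjoin_subset rough_eq_iff
        lower_rmeet upper_rmeet lower_rjoin upper_rjoin)
qed

section \<open>Laws of \<open>L\<close>, \<open>U\<close> and the bounds\<close>

lemmas approx_simps = lower_subset_S upper_subset_S lower_lower upper_lower lower_upper upper_upper
  lower_S upper_S rmeet_subset rjoin_subset lower_rmeet upper_rmeet lower_rjoin upper_rjoin
lemmas Q_simps = Q_meet(2) Q_join(2) Lop_Q Uop_Q rough_eq_iff le_Q approx_simps

lemma Lop_le_Q: "x \<in> carrier RA \<Longrightarrow> Lop RA x \<sqsubseteq>\<^bsub>RA\<^esub> x"
  by (elim Q_E) (simp add: Q_simps lower_subset_upper)

lemma le_Uop_Q: "x \<in> carrier RA \<Longrightarrow> x \<sqsubseteq>\<^bsub>RA\<^esub> Uop RA x"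
  by (elim Q_E) (simp add: Q_simps lower_subset_upper)

lemma Uop_closed_Q: "x \<in> carrier RA \<Longrightarrow> Uop RA x \<in> carrier RA"
  by (elim Q_E) (simp add: Q_simps)

lemma Lop_Lop_Q: "x \<in> carrier RA \<Longrightarrow> Lop RA (Lop RA x) = Lop RA x"
  by (elim Q_E) (simp add: Q_simps)

lemma Uop_Lop_Q: "x \<in> carrier RA \<Longrightarrow> Uop RA (Lop RA x) = Lop RA x"
  by (elim Q_E) (simp add: Q_simps)

lemma Lop_meet_Q:
  "\<lbrakk>x \<in> carrier RA; y \<in> carrier RA\<rbrakk> \<Longrightarrow> Lop RA (x \<sqinter>\<^bsub>RA\<^esub> y) = Lop RA x \<sqinter>\<^bsub>RA\<^esub> Lop RA y"
  \<comment> \<open>Two stages: expanding \<open>lower (rmeet A B)\<close> at once would leave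
    approximations of a bare intersection, for which no rewrite rule is given.\<close>
  by (elim Q_E, simp add: Q_meet(2) Lop_Q lower_subset_S rmeet_subset
      rough_eq_iff lower_lower upper_lower)
    (simp add: approx_simps)

lemma Lop_join_Q:
  "\<lbrakk>x \<in> carrier RA; y \<in> carrier RA\<rbrakk> \<Longrightarrow> Lop RA (x \<squnion>\<^bsub>RA\<^esub> y) = Lop RA x \<squnion>\<^bsub>RA\<^esub> Lop RA y"
  by (elim Q_E, simp add: Q_join(2) Lop_Q lower_subset_S rjoin_subset
      rough_eq_iff lower_lower upper_lower)
    (simp add: approx_simps)

lemma unity_in_Q: "unity RA \<in> carrier RA"
  by (simp add: unity_Q)

lemma Lop_unity_Q: "Lop RA (unity RA) = unity RA"
  by (simp add: unity_Q Q_simps)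

lemma le_unity_Q: "x \<in> carrier RA \<Longrightarrow> x \<sqsubseteq>\<^bsub>RA\<^esub> unity RA"
  by (elim Q_E) (simp add: unity_Q Q_simps)

text \<open>The negation of \<open>1\<close> is the class of the empty set, whose approximations are
  both empty.\<close>

lemma neg_unity_le_Q: "x \<in> carrier RA \<Longrightarrow> neg RA (unity RA) \<sqsubseteq>\<^bsub>RA\<^esub> x"
  by (elim Q_E)
    (simp add: unity_Q neg_Q le_Q lower_S upper_S lower_compl[of S, simplified]
      upper_compl[of S, simplified])

end

text \<open>The provisos exclude degenerate filters: all of \<open>Q\<close> is closed under
  negation, and the empty filter is so vacuously while lacking \<open>1\<close>.\<close>

theorem proposition11:
  fixes S :: "'a set" and R :: "('a \<times> 'a) set" and K :: "'a set set set"
  defines "Q \<equiv> rough_algebra S R"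
  assumes approximation_space: "equiv S R"
    and filter: "lattice_L_filter Q K"
  shows "(K \<noteq> carrier Q \<longrightarrow> \<not> pre_rough_algebra (induced_system Q K)) \<and>
    \<comment> \<open>1\<close>
    distributive_lattice (induced_system Q K) \<and>
    \<comment> \<open>2\<close>
    (\<forall>x\<in>K. Lop Q x \<in> K) \<and>
    (\<forall>x\<in>K. Uop Q x \<in> K) \<and>
    (K \<noteq> {} \<and> K \<noteq> carrier Q \<longrightarrow> \<not> (\<forall>x\<in>K. neg Q x \<in> K)) \<and>
    \<comment> \<open>3\<close>
    (\<forall>x\<in>K. Lop Q x \<sqsubseteq>\<^bsub>Q\<^esub> x) \<and>
    (\<forall>a\<in>K. \<forall>b\<in>K. Lop Q (a \<sqinter>\<^bsub>Q\<^esub> b) = Lop Q a \<sqinter>\<^bsub>Q\<^esub> Lop Q b) \<and>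
    (\<forall>x\<in>K. Lop Q (Lop Q x) = Lop Q x) \<and>
    \<comment> \<open>4\<close>
    (K \<noteq> {} \<longrightarrow> unity Q \<in> K) \<and>
    Lop Q (unity Q) = unity Q \<and>
    (\<forall>x\<in>K. Uop Q (Lop Q x) = Lop Q x) \<and>
    (\<forall>a\<in>K. \<forall>b\<in>K. Lop Q (a \<squnion>\<^bsub>Q\<^esub> b) = Lop Q a \<squnion>\<^bsub>Q\<^esub> Lop Q b)"
proof -
  interpret approximation_space S R
    by (rule approximation_space.intro[OF approximation_space])
  have sub: "K \<subseteq> carrier Q" and up: "\<And>x y. \<lbrakk>x \<in> K; y \<in> carrier Q; x \<sqsubseteq>\<^bsub>Q\<^esub> y\<rbrakk> \<Longrightarrow> y \<in> K"
    and Lop: "\<And>x. x \<in> K \<Longrightarrow> Lop Q x \<in> K"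
    and meet: "\<And>x y. \<lbrakk>x \<in> K; y \<in> K\<rbrakk> \<Longrightarrow> x \<sqinter>\<^bsub>Q\<^esub> y \<in> K"
    and join: "\<And>x y. \<lbrakk>x \<in> K; y \<in> K\<rbrakk> \<Longrightarrow> x \<squnion>\<^bsub>Q\<^esub> y \<in> K"
    using filter unfolding lattice_L_filter_def L_filter_def by blast+
  have K_Q: "x \<in> carrier Q" if "x \<in> K" for x
    using sub that by auto
  have unity: "unity Q \<in> K" if "K \<noteq> {}"
  proof -
    from that obtain x where "x \<in> K" by auto
    then show ?thesis
      using up[of x "unity Q"] K_Q unity_in_Q le_unity_Q unfolding Q_def by blast
  qed
  have neg: "\<not> (\<forall>x\<in>K. neg Q x \<in> K)" if "K \<noteq> {}" "K \<noteq> carrier Q"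
  proof
    assume "\<forall>x\<in>K. neg Q x \<in> K"
    with unity that have "neg Q (unity Q) \<in> K" by blast
    then have "carrier Q \<subseteq> K"
      using up neg_unity_le_Q unfolding Q_def by blast
    with sub that show False by blast
  qed
  have not_pre_rough: "\<not> pre_rough_algebra (induced_system Q K)" if "K \<noteq> carrier Q"
  proof
    assume "pre_rough_algebra (induced_system Q K)"
    then interpret I: pre_rough_algebra "induced_system Q K" .
    \<comment> \<open>A pre-rough algebra has a bottom element, which settles the empty case;
      totality of negation then contradicts \<open>neg\<close>.\<close>
    have "K \<noteq> {}"
      using I.bottom_closed by (auto simp: induced_system_def)
    moreover have "\<forall>x\<in>K. neg Q x \<in> K"
      using I.neg_closed by (simp add: induced_system_def)
    ultimately show False
      using neg that by blast
  qed
  have "distributive_lattice (induced_system Q K)"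
    unfolding induced_system_def
    using Q.sublattice[of K] sub meet join unfolding Q_def by blast
  \<comment> \<open>Unlike closure under \<open>L\<close>, this is not an axiom of filters; it
    follows from upward closure, as \<open>U\<close> is inflationary.\<close>
  moreover have "Uop Q x \<in> K" if "x \<in> K" for x
    using up[OF that, of "Uop Q x"] K_Q[OF that] Uop_closed_Q le_Uop_Q unfolding Q_def by blast
  ultimately show ?thesis
    using not_pre_rough neg Lop unity K_Q Lop_le_Q Lop_meet_Q Lop_Lop_Q Lop_unity_Q Uop_Lop_Q
      Lop_join_Q
    unfolding Q_def by (intro conjI ballI impI) (simp_all)
qed

end
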